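(* Let $E_u$ be a Dedekind complete Riesz space with strong order unit $u$, and let $T$ be a strictly positive conditional expectation on $E_u$ with $Tu=u$. Let $(P_j)_{j\in\mathbb{N}}$ be a Bernoulli process of band projections on $E_u$ with $TP_ju=f$ for all $j\in\mathbb{N}$, for some fixed $f\in E_u$. For $n\ge 1$ let $S_n=\sum_{j=1}^n P_ju$. Then $$TP_{(S_n-tu)^+}u\;\leq\;\left(\frac{n e\|f\|_u}{t}\right)^t\exp(-nf)$$ for every real number $t>0$ such that $t>n\|f\|_u$.
   Context: $E_u$ is a Dedekind complete Riesz space with strong order unit $u$. By the Yosida representation theorem there are a compact Hausdorff space $K$ and a Riesz isomorphism $\varphi:E_u\to C(K)$ with $\varphi(u)=1$; $E_u$ carries the $f$-algebra multiplication transported by $\varphi$, for which $u$ is the unit. The gauge norm is $\|x\|_u=\inf\{\beta\in\mathbb{R}: |x|\le\beta u\}$. The exponential is $\exp(x)=\varphi^{-1}(\exp\circ\varphi(x))=\sum_{k\ge0}x^k/k!$ (order limit, $x^0=u$). A conditional expectation $T$ is a positive order continuous linear projection mapping weak order units to weak order units whose range $R(T)$ is a Dedekind complete Riesz subspace. It is strictly positive if $T|x|=0$ implies $x=0$. For $x\in E_u$, $P_{x^+}$ is the band projection onto the band generated by $x^+$. Independence: band projections $P,Q$ are $T$-conditionally independent if $TPQu=TPu\cdot TQu$. Two Riesz subspaces $E_1,E_2$ are $T$-conditionally independent if all band projections $P_1,P_2$ with $P_iu\in E_i$ are $T$-conditionally independent. A family $(E_\lambda)_{\lambda\in\Lambda}$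 of (order) closed Riesz subspaces containing $R(T)$ is $T$-conditionally independent if for every pair of disjoint subsets $\Lambda_1,\Lambda_2\subset\Lambda$ the closed Riesz subspaces generated by $\bigcup_{\lambda\in\Lambda_1}E_\lambda$ and by $\bigcup_{\lambda\in\Lambda_2}E_\lambda$ are $T$-conditionally independent. Elements $(f_n)$ are $T$-conditionally independent if the family of closed Riesz subspaces $\langle\{f_n\}\cup R(T)\rangle$ generated by $f_n$ and $R(T)$ is; band projections $(P_n)$ are $T$-conditionally independent if the elements $(P_nu)$ are. A Bernoulli process is a sequence $(P_k)_{k\in\mathbb{N}}$ of $T$-conditionally independent band projections (with $Tu=u$) such that $TP_ku=f$ for all $k$, for some fixed $f\in E_u$. *)

theory Defs
  imports "HOL-Analysis.Analysis" "HOL-Library.Lattice_Algebras"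
begin

section \<open>Dedekind complete Riesz spaces\<close>

class dedekind_complete_riesz_space =
  ordered_real_vector + lattice_ab_group_add_abs + conditionally_complete_lattice

definition strong_order_unit :: "'a::dedekind_complete_riesz_space \<Rightarrow> bool" where
  "strong_order_unit u \<longleftrightarrow> 0 \<le> u \<and> (\<forall>x. \<exists>\<beta>::real. \<bar>x\<bar> \<le> \<beta> *\<^sub>R u)"

definition gauge_norm :: "'a::dedekind_complete_riesz_space \<Rightarrow> 'a \<Rightarrow> real" where
  "gauge_norm u x = Inf {\<beta>. \<bar>x\<bar> \<le> \<beta> *\<^sub>R u}"

definition decreases_to_zero :: "'a::dedekind_complete_riesz_space set \<Rightarrow> bool" where
  "decreases_to_zero D \<longleftrightarrow> D \<noteq> {} \<and> (\<forall>a\<in>D. \<forall>b\<in>D. \<exists>c\<in>D. c \<le> a \<and> c \<le> b)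
     \<and> (\<forall>d\<in>D. 0 \<le> d) \<and> Inf D = 0"

text \<open>Order convergence, with nets replaced by filters: a net converges to \<open>l\<close> in order iff,
  for some family decreasing to \<open>0\<close>, each member of the family eventually dominates the distance
  of the net to \<open>l\<close>.\<close>

definition order_converges ::
    "('b \<Rightarrow> 'a::dedekind_complete_riesz_space) \<Rightarrow> 'a \<Rightarrow> 'b filter \<Rightarrow> bool" where
  "order_converges f l F \<longleftrightarrow>
     (\<exists>D. decreases_to_zero D \<and> (\<forall>d\<in>D. \<forall>\<^sub>F a in F. \<bar>f a - l\<bar> \<le> d))"

text \<open>A net in a set induces a filter on the space itself, so filters on \<open>'a\<close> suffice here.\<close>

definition order_closed :: "'a::dedekind_complete_riesz_space set \<Rightarrow> bool" where
  "order_closed S \<longleftrightarrow>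
     (\<forall>F l. F \<noteq> bot \<and> (\<forall>\<^sub>F x in F. x \<in> S) \<and> order_converges (\<lambda>x. x) l F \<longrightarrow> l \<in> S)"

definition order_continuous ::
    "('a::dedekind_complete_riesz_space \<Rightarrow> 'a) \<Rightarrow> bool" where
  "order_continuous T \<longleftrightarrow>
     (\<forall>F l. order_converges (\<lambda>x. x) l F \<longrightarrow> order_converges T (T l) F)"

definition riesz_subspace :: "'a::dedekind_complete_riesz_space set \<Rightarrow> bool" where
  "riesz_subspace S \<longleftrightarrow> subspace S \<and> (\<forall>x\<in>S. \<forall>y\<in>S. sup x y \<in> S \<and> inf x y \<in> S)"

definition closed_riesz_subspace_generated ::
    "'a::dedekind_complete_riesz_space set \<Rightarrow> 'a set" where
  "closed_riesz_subspace_generated A = \<Inter>{S. riesz_subspace S \<and> order_closed S \<and> A \<subseteq> S}"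

text \<open>Dedekind completeness of a subset in its own right: suprema are formed inside \<open>S\<close>.\<close>

definition dedekind_complete_on :: "'a::dedekind_complete_riesz_space set \<Rightarrow> bool" where
  "dedekind_complete_on S \<longleftrightarrow>
     (\<forall>A\<subseteq>S. A \<noteq> {} \<and> (\<exists>b\<in>S. \<forall>a\<in>A. a \<le> b) \<longrightarrow>
        (\<exists>s\<in>S. (\<forall>a\<in>A. a \<le> s) \<and> (\<forall>b\<in>S. (\<forall>a\<in>A. a \<le> b) \<longrightarrow> s \<le> b)))"


section \<open>Bands and band projections\<close>

definition band :: "'a::dedekind_complete_riesz_space set \<Rightarrow> bool" where
  "band B \<longleftrightarrow> subspace B \<and> (\<forall>x\<in>B. \<forall>y. \<bar>y\<bar> \<le> \<bar>x\<bar> \<longrightarrow> y \<in> B) \<and> order_closed B"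

definition band_generated :: "'a::dedekind_complete_riesz_space set \<Rightarrow> 'a set" where
  "band_generated A = \<Inter>{B. band B \<and> A \<subseteq> B}"

definition disjoint_complement :: "'a::dedekind_complete_riesz_space set \<Rightarrow> 'a set" where
  "disjoint_complement B = {x. \<forall>y\<in>B. inf \<bar>x\<bar> \<bar>y\<bar> = 0}"

text \<open>By Dedekind completeness the space is the direct sum of each band and its disjoint
  complement, so the description below is proper whenever \<open>B\<close> is a band.\<close>

definition band_proj :: "'a::dedekind_complete_riesz_space set \<Rightarrow> 'a \<Rightarrow> 'a" where
  "band_proj B x = (THE y. y \<in> B \<and> x - y \<in> disjoint_complement B)"

definition band_projection :: "('a::dedekind_complete_riesz_space \<Rightarrow> 'a) \<Rightarrow> bool" where
  "band_projection P \<longleftrightarrow> (\<exists>B. band B \<and> P = band_proj B)"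

definition weak_order_unit :: "'a::dedekind_complete_riesz_space \<Rightarrow> bool" where
  "weak_order_unit e \<longleftrightarrow> 0 \<le> e \<and> band_generated {e} = UNIV"


section \<open>Yosida representation, multiplication and exponential\<close>

text \<open>\<open>C(K)\<close>; extensionality makes its elements correspond one-to-one to the continuous
  functions on the carrier of \<open>K\<close>.\<close>

definition cont_funs :: "'k topology \<Rightarrow> ('k \<Rightarrow> real) set" where
  "cont_funs K = {g. continuous_map K euclideanreal g} \<inter> extensional (topspace K)"

definition yosida_representation ::
    "'k topology \<Rightarrow> ('a::dedekind_complete_riesz_space \<Rightarrow> 'k \<Rightarrow> real) \<Rightarrow> 'a \<Rightarrow> bool" where
  "yosida_representation K \<phi> u \<longleftrightarrow>
     compact_space K \<and> Hausdorff_space K \<and> bij_betw \<phi> UNIV (cont_funs K) \<and>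
     (\<forall>k\<in>topspace K.
        (\<forall>x y. \<phi> (x + y) k = \<phi> x k + \<phi> y k) \<and>
        (\<forall>c x. \<phi> (c *\<^sub>R x) k = c * \<phi> x k) \<and>
        (\<forall>x y. \<phi> (sup x y) k = max (\<phi> x k) (\<phi> y k)) \<and>
        (\<forall>x y. \<phi> (inf x y) k = min (\<phi> x k) (\<phi> y k)) \<and>
        \<phi> u k = 1)"

definition riesz_mult ::
    "'k topology \<Rightarrow> ('a::dedekind_complete_riesz_space \<Rightarrow> 'k \<Rightarrow> real) \<Rightarrow> 'a \<Rightarrow> 'a \<Rightarrow> 'a" where
  "riesz_mult K \<phi> x y = inv \<phi> (\<lambda>k\<in>topspace K. \<phi> x k * \<phi> y k)"

definition riesz_exp ::
    "'k topology \<Rightarrow> ('a::dedekind_complete_riesz_space \<Rightarrow> 'k \<Rightarrow> real) \<Rightarrow> 'a \<Rightarrow> 'a" where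
  "riesz_exp K \<phi> x = inv \<phi> (\<lambda>k\<in>topspace K. exp (\<phi> x k))"


section \<open>Conditional expectations and conditional independence\<close>

definition conditional_expectation :: "('a::dedekind_complete_riesz_space \<Rightarrow> 'a) \<Rightarrow> bool" where
  "conditional_expectation T \<longleftrightarrow>
     linear T \<and> (\<forall>x\<ge>0. 0 \<le> T x) \<and> order_continuous T \<and> (\<forall>x. T (T x) = T x) \<and>
     (\<forall>e. weak_order_unit e \<longrightarrow> weak_order_unit (T e)) \<and>
     riesz_subspace (range T) \<and> dedekind_complete_on (range T)"

definition strictly_positive :: "('a::dedekind_complete_riesz_space \<Rightarrow> 'a) \<Rightarrow> bool" where
  "strictly_positive T \<longleftrightarrow> (\<forall>x. T \<bar>x\<bar> = 0 \<longrightarrow> x = 0)"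

text \<open>Below, \<open>K\<close> and \<open>\<phi>\<close> only serve to determine the multiplication.\<close>

definition projections_cond_indep ::
    "'k topology \<Rightarrow> ('a::dedekind_complete_riesz_space \<Rightarrow> 'k \<Rightarrow> real) \<Rightarrow> 'a \<Rightarrow> ('a \<Rightarrow> 'a) \<Rightarrow>
     ('a \<Rightarrow> 'a) \<Rightarrow> ('a \<Rightarrow> 'a) \<Rightarrow> bool" where
  "projections_cond_indep K \<phi> u T P Q \<longleftrightarrow>
     T (P (Q u)) = riesz_mult K \<phi> (T (P u)) (T (Q u))"

definition subspaces_cond_indep ::
    "'k topology \<Rightarrow> ('a::dedekind_complete_riesz_space \<Rightarrow> 'k \<Rightarrow> real) \<Rightarrow> 'a \<Rightarrow> ('a \<Rightarrow> 'a) \<Rightarrow>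
     'a set \<Rightarrow> 'a set \<Rightarrow> bool" where
  "subspaces_cond_indep K \<phi> u T E1 E2 \<longleftrightarrow>
     (\<forall>P Q. band_projection P \<and> band_projection Q \<and> P u \<in> E1 \<and> Q u \<in> E2 \<longrightarrow>
        projections_cond_indep K \<phi> u T P Q)"

definition family_cond_indep ::
    "'k topology \<Rightarrow> ('a::dedekind_complete_riesz_space \<Rightarrow> 'k \<Rightarrow> real) \<Rightarrow> 'a \<Rightarrow> ('a \<Rightarrow> 'a) \<Rightarrow>
     'i set \<Rightarrow> ('i \<Rightarrow> 'a set) \<Rightarrow> bool" where
  "family_cond_indep K \<phi> u T \<Lambda> E \<longleftrightarrow>
     (\<forall>i\<in>\<Lambda>. riesz_subspace (E i) \<and> order_closed (E i) \<and> range T \<subseteq> E i) \<and>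
     (\<forall>I J. I \<subseteq> \<Lambda> \<and> J \<subseteq> \<Lambda> \<and> I \<inter> J = {} \<longrightarrow>
        subspaces_cond_indep K \<phi> u T
          (closed_riesz_subspace_generated (\<Union>i\<in>I. E i))
          (closed_riesz_subspace_generated (\<Union>j\<in>J. E j)))"

definition elements_cond_indep ::
    "'k topology \<Rightarrow> ('a::dedekind_complete_riesz_space \<Rightarrow> 'k \<Rightarrow> real) \<Rightarrow> 'a \<Rightarrow> ('a \<Rightarrow> 'a) \<Rightarrow>
     'i set \<Rightarrow> ('i \<Rightarrow> 'a) \<Rightarrow> bool" where
  "elements_cond_indep K \<phi> u T \<Lambda> f \<longleftrightarrow>
     family_cond_indep K \<phi> u T \<Lambda>
       (\<lambda>i. closed_riesz_subspace_generated ({f i} \<union> range T))"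

text \<open>The sequence is indexed by the positive integers; its value at \<open>0\<close> is irrelevant.\<close>

definition bernoulli_process ::
    "'k topology \<Rightarrow> ('a::dedekind_complete_riesz_space \<Rightarrow> 'k \<Rightarrow> real) \<Rightarrow> 'a \<Rightarrow> ('a \<Rightarrow> 'a) \<Rightarrow>
     (nat \<Rightarrow> 'a \<Rightarrow> 'a) \<Rightarrow> 'a \<Rightarrow> bool" where
  "bernoulli_process K \<phi> u T P f \<longleftrightarrow>
     T u = u \<and> (\<forall>j\<ge>1. band_projection (P j)) \<and>
     elements_cond_indep K \<phi> u T {1..} (\<lambda>j. P j u) \<and> (\<forall>j\<ge>1. T (P j u) = f)"

end

theory Submission
  imports Defs
begin

text \<open>The Chernoff method. For \<open>c = t / (n \<parallel>f\<parallel>\<^sub>u) - 1 > 0\<close> the projection of \<open>u\<close> onto the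
  band generated by \<open>(S\<^sub>n - t u)\<^sup>+\<close> is at most \<open>(1 + c) powr (-t)\<close> times
  \<open>\<Prod>j\<le>n. (u + c P\<^sub>j u)\<close>. This product is a linear combination of the infima of
  \<open>{P\<^sub>j u | j \<in> A}\<close> with \<open>A \<subseteq> {1..n}\<close>; by independence \<open>T\<close> maps such an infimum to
  \<open>f ^ card A\<close>, hence the product to \<open>(u + c f) ^ n \<le> exp (n c f) \<le> exp t \<cdot> exp (- n f)\<close>.\<close>

section \<open>Disjointness and bands\<close>

lemma abs_scaleR_le:
  fixes x :: "'a::dedekind_complete_riesz_space"
  shows "\<bar>c *\<^sub>R x\<bar> \<le> \<bar>c\<bar> *\<^sub>R \<bar>x\<bar>"
proof -
  have nonneg: "\<bar>r *\<^sub>R y\<bar> \<le> r *\<^sub>R \<bar>y\<bar>" if "r \<ge> 0" for r and y :: 'a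
    using scaleR_left_mono[OF abs_ge_self that, of y]
      scaleR_left_mono[OF abs_ge_minus_self that, of y]
    by (intro abs_leI) auto
  show ?thesis
    using nonneg[of c x] nonneg[of "-c" "-x"] by (cases "c \<ge> 0") auto
qed

text \<open>Distributivity turns the right-hand side into an infimum of four sums, each of which
  dominates the left-hand side. This is what makes disjointness additive.\<close>

lemma inf_add_le:
  fixes a b c :: "'a::lattice_ab_group_add"
  assumes "0 \<le> a" "0 \<le> b" "0 \<le> c"
  shows "inf (a + b) c \<le> inf a c + inf b c"
proof -
  have "inf a c + inf b c = inf (inf (a + b) (c + b)) (inf (a + c) (c + c))"
    by (simp add: add_inf_distrib_left add_inf_distrib_right)
  moreover have "inf (a + b) c \<le> c + b" "inf (a + b) c \<le> a + c" "inf (a + b) c \<le> c + c"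
    using assms by (auto intro!: le_infI2 simp: add_increasing add_increasing2)
  ultimately show ?thesis by simp
qed

lemma disjoint_scaleR:
  fixes a b :: "'a::dedekind_complete_riesz_space"
  assumes "inf a b = 0" "0 \<le> r"
  shows "inf (r *\<^sub>R a) b = 0"
proof -
  have ab: "0 \<le> a" "0 \<le> b"
    using assms(1) by (metis inf.cobounded1, metis inf.cobounded2)
  \<comment> \<open>Since \<open>s\<close> is at least both \<open>r\<close> and 1, the infimum
    \<open>z\<close> lies below \<open>s\<close> times \<open>a\<close> and \<open>s\<close> times
    \<open>b\<close>; dividing by \<open>s\<close> puts it below \<open>inf a b\<close>, which is
    0.\<close>
  define s where "s = max r 1"
  have s: "s > 0" "r \<le> s" "1 \<le> s" by (auto simp: s_def)
  define z where "z = inf (r *\<^sub>R a) b"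
  have "z \<le> s *\<^sub>R a" "z \<le> s *\<^sub>R b"
    using scaleR_right_mono[OF s(2) ab(1)] scaleR_right_mono[OF s(3) ab(2)]
    by (auto simp: z_def intro: le_infI1 le_infI2)
  then have "(1 / s) *\<^sub>R z \<le> a" "(1 / s) *\<^sub>R z \<le> b"
    using s(1) by (simp_all add: pos_divideR_le_eq divide_inverse_commute)
  then have "(1 / s) *\<^sub>R z \<le> 0"
    using assms(1) by (metis inf.boundedI)
  then have "z \<le> 0"
    using s(1) pos_divideR_le_eq[of s z 0] by (simp add: divide_inverse_commute)
  moreover have "0 \<le> z"
    using ab assms(2) by (simp add: z_def scaleR_nonneg_nonneg)
  ultimately show ?thesis unfolding z_def by (rule antisym)
qed

text \<open>Subadditivity of the infimum gives closure under sums. For an order limit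
  \<open>l\<close>, some \<open>a\<close> in the complement satisfies \<bar>a - l\<bar> \<le> d; as
  \<open>a\<close> is disjoint from \<open>z\<close>, the overlap of \<open>l\<close> with
  \<open>z\<close> is at most \<open>d\<close>, for every \<open>d\<close> in a family with infimum
  0.\<close>

lemma band_disjoint_complement: "band (disjoint_complement A)"
  unfolding band_def
proof (intro conjI ballI allI impI)
  show "subspace (disjoint_complement A)"
    unfolding subspace_def
  proof (intro conjI ballI allI)
    show "0 \<in> disjoint_complement A"
      by (simp add: disjoint_complement_def inf.absorb1)
  next
    fix x y assume xy: "x \<in> disjoint_complement A" "y \<in> disjoint_complement A"
    have "inf \<bar>x + y\<bar> \<bar>z\<bar> = 0" if "z \<in> A" for z
    proof (rule antisym)
      have "inf \<bar>x + y\<bar> \<bar>z\<bar> \<le> inf (\<bar>x\<bar> + \<bar>y\<bar>) \<bar>z\<bar>"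
        by (intro inf_mono abs_triangle_ineq order_refl)
      also have "\<dots> \<le> inf \<bar>x\<bar> \<bar>z\<bar> + inf \<bar>y\<bar> \<bar>z\<bar>"
        by (intro inf_add_le abs_ge_zero)
      also have "\<dots> = 0"
        using xy that by (simp add: disjoint_complement_def)
      finally show "inf \<bar>x + y\<bar> \<bar>z\<bar> \<le> 0" .
    qed simp
    then show "x + y \<in> disjoint_complement A"
      by (simp add: disjoint_complement_def)
  next
    fix c :: real and x assume x: "x \<in> disjoint_complement A"
    have "inf \<bar>c *\<^sub>R x\<bar> \<bar>z\<bar> = 0" if "z \<in> A" for z
    proof (rule antisym)
      have "inf \<bar>c *\<^sub>R x\<bar> \<bar>z\<bar> \<le> inf (\<bar>c\<bar> *\<^sub>R \<bar>x\<bar>) \<bar>z\<bar>"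
        by (intro inf_mono abs_scaleR_le order_refl)
      also have "\<dots> = 0"
        using x that by (intro disjoint_scaleR) (auto simp: disjoint_complement_def)
      finally show "inf \<bar>c *\<^sub>R x\<bar> \<bar>z\<bar> \<le> 0" .
    qed simp
    then show "c *\<^sub>R x \<in> disjoint_complement A"
      by (simp add: disjoint_complement_def)
  qed
next
  fix x y assume x: "x \<in> disjoint_complement A" and "\<bar>y\<bar> \<le> \<bar>x\<bar>"
  have "inf \<bar>y\<bar> \<bar>z\<bar> = 0" if "z \<in> A" for z
  proof (rule antisym)
    have "inf \<bar>y\<bar> \<bar>z\<bar> \<le> inf \<bar>x\<bar> \<bar>z\<bar>"
      using \<open>\<bar>y\<bar> \<le> \<bar>x\<bar>\<close> by (intro inf_mono) auto
    also have "\<dots> = 0" using x that by (simp add: disjoint_complement_def)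
    finally show "inf \<bar>y\<bar> \<bar>z\<bar> \<le> 0" .
  qed simp
  then show "y \<in> disjoint_complement A"
    by (simp add: disjoint_complement_def)
next
  show "order_closed (disjoint_complement A)"
    unfolding order_closed_def
  proof (intro allI impI, elim conjE)
    fix F and l :: 'a
    assume F: "F \<noteq> bot" and ev: "\<forall>\<^sub>F x in F. x \<in> disjoint_complement A"
      and "order_converges (\<lambda>x. x) l F"
    then obtain D where D: "decreases_to_zero D" and "\<forall>d\<in>D. \<forall>\<^sub>F a in F. \<bar>a - l\<bar> \<le> d"
      unfolding order_converges_def by blast
    have "inf \<bar>l\<bar> \<bar>z\<bar> = 0" if "z \<in> A" for z
    proof (rule antisym)
      have "inf \<bar>l\<bar> \<bar>z\<bar> \<le> d" if "d \<in> D" for d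
      proof -
        have "\<forall>\<^sub>F a in F. \<bar>a - l\<bar> \<le> d \<and> a \<in> disjoint_complement A"
          using \<open>\<forall>d\<in>D. \<forall>\<^sub>F a in F. \<bar>a - l\<bar> \<le> d\<close> \<open>d \<in> D\<close> ev by (auto intro: eventually_conj)
        then obtain a where a: "\<bar>a - l\<bar> \<le> d" "a \<in> disjoint_complement A"
          using F eventually_happens' by blast
        have "inf \<bar>l\<bar> \<bar>z\<bar> \<le> inf (\<bar>a\<bar> + \<bar>a - l\<bar>) \<bar>z\<bar>"
          using abs_triangle_ineq4[of a "a - l"] by (intro inf_mono) auto
        also have "\<dots> \<le> inf \<bar>a\<bar> \<bar>z\<bar> + inf \<bar>a - l\<bar> \<bar>z\<bar>"
          by (intro inf_add_le abs_ge_zero)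
        also have "\<dots> = inf \<bar>a - l\<bar> \<bar>z\<bar>"
          using a(2) \<open>z \<in> A\<close> by (simp add: disjoint_complement_def)
        also have "\<dots> \<le> d"
          using a(1) by (rule le_infI1)
        finally show ?thesis .
      qed
      then have "inf \<bar>l\<bar> \<bar>z\<bar> \<le> Inf D"
        using D unfolding decreases_to_zero_def by (intro cInf_greatest) auto
      then show "inf \<bar>l\<bar> \<bar>z\<bar> \<le> 0"
        using D unfolding decreases_to_zero_def by simp
    qed simp
    then show "l \<in> disjoint_complement A"
      by (simp add: disjoint_complement_def)
  qed
qed

section \<open>Generated bands and the projection onto a band\<close>

lemma band_band_generated: "band (band_generated A)"
proof -
  have "order_closed (band_generated A)"
    unfolding order_closed_def
  proof (intro allI impI, elim conjE)
    fix F and l :: 'a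
    assume F: "F \<noteq> bot" "\<forall>\<^sub>F x in F. x \<in> band_generated A" "order_converges (\<lambda>x. x) l F"
    have "l \<in> B" if "band B" "A \<subseteq> B" for B
    proof -
      have "\<forall>\<^sub>F x in F. x \<in> B"
        using F(2) by eventually_elim (use that in \<open>auto simp: band_generated_def\<close>)
      then show ?thesis
        using F(1,3) \<open>band B\<close> unfolding band_def order_closed_def by blast
    qed
    then show "l \<in> band_generated A" by (simp add: band_generated_def)
  qed
  moreover have "subspace (band_generated A)"
    unfolding band_generated_def by (rule subspace_Inter) (auto simp: band_def)
  moreover have "y \<in> band_generated A" if "x \<in> band_generated A" "\<bar>y\<bar> \<le> \<bar>x\<bar>" for x y
    using that unfolding band_generated_def band_def by blast
  ultimately show ?thesis unfolding band_def by blast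
qed

text \<open>Two candidates differ by an element of both \<open>B\<close> and its complement; such an
  element is disjoint from itself, hence 0.\<close>

lemma band_proj_eqI:
  assumes "band B" "y \<in> B" "x - y \<in> disjoint_complement B"
  shows "band_proj B x = y"
  unfolding band_proj_def
proof (rule the_equality)
  show "y \<in> B \<and> x - y \<in> disjoint_complement B" using assms by blast
next
  fix z assume z: "z \<in> B \<and> x - z \<in> disjoint_complement B"
  have "z - y \<in> B"
    using assms z by (auto simp: band_def intro: subspace_diff)
  moreover have "(x - y) - (x - z) \<in> disjoint_complement B"
    using assms z band_disjoint_complement[of B] unfolding band_def by (blast intro: subspace_diff)
  then have "z - y \<in> disjoint_complement B" by simp
  ultimately have "inf \<bar>z - y\<bar> \<bar>z - y\<bar> = 0"
    unfolding disjoint_complement_def by blast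
  then show "z = y" by simp
qed

text \<open>Order closedness of a band, applied to the filter of tails of an upward directed set.\<close>

lemma band_Sup_mem:
  assumes "band B" "A \<subseteq> B" "A \<noteq> {}" "bdd_above A"
    and directed: "\<And>a b. a \<in> A \<Longrightarrow> b \<in> A \<Longrightarrow> \<exists>c\<in>A. a \<le> c \<and> b \<le> c"
  shows "Sup A \<in> B"
proof -
  define F where "F = (INF a\<in>A. principal {z \<in> A. a \<le> z})"
  \<comment> \<open>Directedness makes the tails a filter base, so eventual truth means truth on a
    single tail.\<close>
  have ev: "eventually Q F \<longleftrightarrow> (\<exists>a\<in>A. \<forall>z\<in>A. a \<le> z \<longrightarrow> Q z)" for Q
    unfolding F_def
  proof (subst eventually_INF_base)
    fix a b assume "a \<in> A" "b \<in> A"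
    then obtain c where "c \<in> A" "a \<le> c" "b \<le> c" using directed by blast
    then show "\<exists>x\<in>A. principal {z \<in> A. x \<le> z} \<le>
        inf (principal {z \<in> A. a \<le> z}) (principal {z \<in> A. b \<le> z})"
      by (intro bexI[of _ c]) auto
  qed (use assms in \<open>auto simp: eventually_principal\<close>)
  have "F \<noteq> bot"
    using ev[of "\<lambda>_. False"] by (auto simp: trivial_limit_def)
  moreover have "\<forall>\<^sub>F z in F. z \<in> B"
    using assms unfolding ev by blast
  moreover have "order_converges (\<lambda>x. x) (Sup A) F"
    unfolding order_converges_def
  proof (intro exI conjI ballI)
    \<comment> \<open>These differences are directed downwards because \<open>A\<close> is directed
      upwards. Subtracting their infimum from \<open>Sup A\<close> leaves an upper bound of
      \<open>A\<close>, so that infimum is 0.\<close>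
    let ?D = "(\<lambda>a. Sup A - a) ` A"
    have up: "a \<le> Sup A" if "a \<in> A" for a
      using that assms(4) by (rule cSup_upper)
    have "Inf ?D = 0"
    proof (rule antisym)
      have "Sup A \<le> Sup A - Inf ?D"
      proof (rule cSup_least[OF assms(3)])
        fix a assume "a \<in> A"
        have "bdd_below ?D" using up by (auto intro!: bdd_belowI[of _ 0])
        then have "Inf ?D \<le> Sup A - a" using \<open>a \<in> A\<close> by (intro cInf_lower) auto
        then show "a \<le> Sup A - Inf ?D" by (simp add: algebra_simps)
      qed
      then show "Inf ?D \<le> 0" by simp
      show "0 \<le> Inf ?D"
        using up assms(3) by (intro cInf_greatest) auto
    qed
    moreover have "\<exists>c\<in>?D. c \<le> a \<and> c \<le> b" if "a \<in> ?D" "b \<in> ?D" for a b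
    proof -
      from that obtain a' b' where ab: "a' \<in> A" "b' \<in> A" "a = Sup A - a'" "b = Sup A - b'" by blast
      then obtain c where "c \<in> A" "a' \<le> c" "b' \<le> c" using directed by blast
      then show ?thesis using ab by (auto intro!: bexI[of _ c])
    qed
    ultimately show "decreases_to_zero ?D"
      using assms(3) up unfolding decreases_to_zero_def by auto
    fix d assume "d \<in> ?D"
    then obtain a where a: "a \<in> A" "d = Sup A - a" by blast
    have "\<bar>z - Sup A\<bar> \<le> d" if "z \<in> A" "a \<le> z" for z
      using up[OF that(1)] that(2) a(2) by (simp add: abs_of_nonpos)
    then show "\<forall>\<^sub>F z in F. \<bar>z - Sup A\<bar> \<le> d"
      using a(1) unfolding ev by blast
  qed
  ultimately show ?thesis
    using \<open>band B\<close> unfolding band_def order_closed_def by blast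
qed

text \<open>The component of \<open>x\<close> in \<open>B\<close> is the supremum of the elements of
  \<open>B\<close> between 0 and \<open>x\<close>; Dedekind completeness provides it and order
  closedness keeps it in \<open>B\<close>.\<close>

lemma band_decomposition:
  fixes x :: "'a::dedekind_complete_riesz_space"
  assumes "band B" "0 \<le> x"
  obtains y where "y \<in> B" "x - y \<in> disjoint_complement B" "0 \<le> y" "y \<le> x"
proof -
  have sub: "subspace B" and solid: "\<And>a b. a \<in> B \<Longrightarrow> \<bar>b\<bar> \<le> \<bar>a\<bar> \<Longrightarrow> b \<in> B"
    using assms(1) by (auto simp: band_def)
  define A where "A = {z \<in> B. 0 \<le> z \<and> z \<le> x}"
  define s where "s = Sup A"
  have "0 \<in> A" using sub assms(2) by (simp add: A_def subspace_0)
  have bdd: "bdd_above A" by (auto simp: A_def intro: bdd_aboveI)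
  have up: "a \<le> s" if "a \<in> A" for a
    unfolding s_def using that bdd by (rule cSup_upper)
  have "s \<in> B"
    unfolding s_def
  proof (rule band_Sup_mem[OF assms(1) _ _ bdd])
    fix a b assume ab: "a \<in> A" "b \<in> A"
    then have "a + b \<in> B" using sub by (auto simp: A_def intro: subspace_add)
    moreover have "\<bar>sup a b\<bar> \<le> \<bar>a + b\<bar>"
      using ab by (simp add: A_def abs_of_nonneg le_supI1)
    ultimately have "sup a b \<in> B" by (rule solid)
    then show "\<exists>c\<in>A. a \<le> c \<and> b \<le> c"
      using ab by (intro bexI[of _ "sup a b"]) (auto simp: A_def le_supI1)
  qed (use \<open>0 \<in> A\<close> in \<open>auto simp: A_def\<close>)
  have "s \<le> x"
    unfolding s_def using \<open>0 \<in> A\<close> by (intro cSup_least) (auto simp: A_def)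
  have "inf \<bar>x - s\<bar> \<bar>y\<bar> = 0" if "y \<in> B" for y
  proof -
    \<comment> \<open>An overlap \<open>z\<close> of the remainder with \<open>B\<close> could be
      added to any member of \<open>A\<close> without leaving \<open>A\<close>. Then
      \<open>s - z\<close> is still an upper bound, which forces z \<le> 0.\<close>
    define z where "z = inf \<bar>x - s\<bar> \<bar>y\<bar>"
    have "0 \<le> z" by (simp add: z_def)
    have "z \<le> x - s" using \<open>s \<le> x\<close> by (simp add: z_def abs_of_nonneg)
    have "z \<in> B"
      using \<open>y \<in> B\<close> by (rule solid) (use \<open>0 \<le> z\<close> in \<open>simp add: abs_of_nonneg z_def\<close>)
    have "a \<le> s - z" if "a \<in> A" for a
    proof -
      have "a + z \<le> s + (x - s)"
        using up[OF that] \<open>z \<le> x - s\<close> by (rule add_mono)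
      then have "a + z \<in> A"
        using that \<open>z \<in> B\<close> \<open>0 \<le> z\<close> sub by (auto simp: A_def intro: subspace_add)
      then show ?thesis using up by (simp add: le_diff_eq)
    qed
    then have "s \<le> s - z"
      using \<open>0 \<in> A\<close> unfolding s_def[symmetric] by (subst s_def, intro cSup_least) auto
    then have "z \<le> 0" by (simp only: le_diff_eq add_le_same_cancel1)
    then show ?thesis using \<open>0 \<le> z\<close> unfolding z_def by (rule antisym)
  qed
  then have "x - s \<in> disjoint_complement B" by (simp add: disjoint_complement_def)
  then show thesis
    using that \<open>s \<in> B\<close> up[OF \<open>0 \<in> A\<close>] \<open>s \<le> x\<close> by blast
qed

text \<open>The decomposition supplies a witness and \<open>band_proj_eqI\<close> its uniqueness, so
  the definite description in \<open>band_proj\<close> denotes that witness.\<close>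

lemma band_proj_nonneg:
  fixes x :: "'a::dedekind_complete_riesz_space"
  assumes "band B" "0 \<le> x"
  shows "band_proj B x \<in> B" "inf (band_proj B x) (x - band_proj B x) = 0"
proof -
  obtain y where y: "y \<in> B" "x - y \<in> disjoint_complement B" "0 \<le> y" "y \<le> x"
    using band_decomposition[OF assms] .
  have eq: "band_proj B x = y" by (rule band_proj_eqI[OF assms(1) y(1,2)])
  show "band_proj B x \<in> B" using y(1) eq by simp
  have "inf \<bar>x - y\<bar> \<bar>y\<bar> = 0" using y(1,2) by (auto simp: disjoint_complement_def)
  then show "inf (band_proj B x) (x - band_proj B x) = 0"
    using y(3,4) eq by (simp add: abs_of_nonneg inf_commute)
qed

text \<open>A component \<open>e\<close> of \<open>u\<close> is the image of \<open>u\<close> under the projection onto the band of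
  elements disjoint from \<open>u - e\<close>.\<close>

lemma component_band_projection:
  fixes u e :: "'a::dedekind_complete_riesz_space"
  assumes "inf e (u - e) = 0"
  obtains Q where "band_projection Q" "\<And>p. 0 \<le> p \<Longrightarrow> p \<le> u \<Longrightarrow> Q p = inf e p"
proof -
  have e: "0 \<le> e" "0 \<le> u - e"
    using assms by (metis inf.cobounded1, metis inf.cobounded2)
  define B where "B = disjoint_complement {u - e}"
  have B: "band B" unfolding B_def by (rule band_disjoint_complement)
  have solid: "\<And>a b. a \<in> C \<Longrightarrow> \<bar>b\<bar> \<le> \<bar>a\<bar> \<Longrightarrow> b \<in> C" if "band C" for C :: "'a set"
    using that by (auto simp: band_def)
  have "e \<in> B" using assms e by (simp add: B_def disjoint_complement_def abs_of_nonneg)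
  have "u - e \<in> disjoint_complement B"
    by (auto simp: B_def disjoint_complement_def inf_commute)
  have "band_proj B p = inf e p" if p: "0 \<le> p" "p \<le> u" for p
  proof (rule band_proj_eqI[OF B])
    show "inf e p \<in> B"
      using B \<open>e \<in> B\<close> by (rule solid) (use e p in \<open>simp add: abs_of_nonneg\<close>)
    \<comment> \<open>The remainder is the positive part of \<open>p - e\<close>, hence at most
      \<open>u - e\<close>; solidity of the complement of \<open>B\<close> then applies.\<close>
    have "p - inf e p = sup (p - e) 0"
      by (simp add: add_sup_distrib_left sup_commute)
    also have "\<dots> \<le> u - e" using e p by (simp add: diff_right_mono)
    finally have "p - inf e p \<le> u - e" .
    moreover have "0 \<le> p - inf e p" by (simp only: diff_ge_0_iff_ge inf.cobounded2)
    ultimately have "\<bar>p - inf e p\<bar> \<le> \<bar>u - e\<bar>" using e by (simp only: abs_of_nonneg)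
    then show "p - inf e p \<in> disjoint_complement B"
      by (rule solid[OF band_disjoint_complement \<open>u - e \<in> disjoint_complement B\<close>])
  qed
  then show thesis using that B unfolding band_projection_def by blast
qed

text \<open>The disjoint complement of \<open>{v}\<close> is a band containing \<open>w\<close>, so
  it contains the band that \<open>w\<close> generates.\<close>

lemma band_generated_disjoint:
  assumes "inf \<bar>w\<bar> \<bar>v\<bar> = 0" "q \<in> band_generated {w}"
  shows "inf \<bar>q\<bar> \<bar>v\<bar> = 0"
proof -
  have "w \<in> disjoint_complement {v}" using assms(1) by (simp add: disjoint_complement_def)
  then have "q \<in> disjoint_complement {v}"
    using assms(2) band_disjoint_complement[of "{v}"] by (auto simp: band_generated_def)
  then show ?thesis by (simp add: disjoint_complement_def)
qed

section \<open>Pointwise reasoning in the Yosida representation\<close>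

locale yosida =
  fixes K :: "'k topology" and \<phi> :: "'a::dedekind_complete_riesz_space \<Rightarrow> 'k \<Rightarrow> real" and u :: 'a
  assumes rep: "yosida_representation K \<phi> u"
begin

lemma add: "k \<in> topspace K \<Longrightarrow> \<phi> (x + y) k = \<phi> x k + \<phi> y k"
  and scaleR: "k \<in> topspace K \<Longrightarrow> \<phi> (c *\<^sub>R x) k = c * \<phi> x k"
  and sup: "k \<in> topspace K \<Longrightarrow> \<phi> (sup x y) k = max (\<phi> x k) (\<phi> y k)"
  and inf: "k \<in> topspace K \<Longrightarrow> \<phi> (inf x y) k = min (\<phi> x k) (\<phi> y k)"
  and unit: "k \<in> topspace K \<Longrightarrow> \<phi> u k = 1"
  using rep unfolding yosida_representation_def by auto

lemma zero: "k \<in> topspace K \<Longrightarrow> \<phi> 0 k = 0"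
  using scaleR[of k 0 0] by simp

lemma uminus: "k \<in> topspace K \<Longrightarrow> \<phi> (- x) k = - \<phi> x k"
  using scaleR[of k "-1" x] by simp

lemma diff: "k \<in> topspace K \<Longrightarrow> \<phi> (x - y) k = \<phi> x k - \<phi> y k"
  using add[of k x "-y"] by (simp add: uminus)

lemma sum: "k \<in> topspace K \<Longrightarrow> \<phi> (\<Sum>i\<in>I. g i) k = (\<Sum>i\<in>I. \<phi> (g i) k)"
  by (induction I rule: infinite_finite_induct) (auto simp: zero add)

lemma abs: "k \<in> topspace K \<Longrightarrow> \<phi> \<bar>x\<bar> k = \<bar>\<phi> x k\<bar>"
  by (simp add: abs_lattice sup uminus sup_max)

lemmas pointwise = add scaleR sup inf unit zero uminus diff sum abs

text \<open>Extensionality lifts agreement on the carrier to equality of functions, and \<phi> is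
  injective. From here on, identities and inequalities in the Riesz space are checked on real values
  at each point.\<close>

lemma eq_iff: "x = y \<longleftrightarrow> (\<forall>k\<in>topspace K. \<phi> x k = \<phi> y k)"
proof
  assume "\<forall>k\<in>topspace K. \<phi> x k = \<phi> y k"
  moreover have "\<phi> z \<in> extensional (topspace K)" for z
    using rep unfolding yosida_representation_def cont_funs_def by (auto simp: bij_betw_def)
  ultimately have "\<phi> x = \<phi> y"
    by (metis extensionalityI)
  moreover have "inj \<phi>"
    using rep unfolding yosida_representation_def bij_betw_def by blast
  ultimately show "x = y" by (simp only: inj_eq)
qed simp

lemma le_iff: "x \<le> y \<longleftrightarrow> (\<forall>k\<in>topspace K. \<phi> x k \<le> \<phi> y k)"
  by (auto simp: le_iff_inf eq_iff[of "inf x y"] inf min_def)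

lemma unit_nonneg: "0 \<le> u"
  by (simp add: le_iff pointwise)

lemma continuous: "continuous_map K euclideanreal (\<phi> x)"
  using rep unfolding yosida_representation_def cont_funs_def by (auto simp: bij_betw_def)

text \<open>The restriction puts \<open>g\<close> among the extensional functions, where
  surjectivity of \<phi> makes \<open>inv \<phi>\<close> a genuine preimage.\<close>

lemma inv_restrict:
  assumes "continuous_map K euclideanreal g" "k \<in> topspace K"
  shows "\<phi> (inv \<phi> (restrict g (topspace K))) k = g k"
proof -
  have "continuous_map K euclideanreal (restrict g (topspace K))"
    using assms(1) by (rule continuous_map_eq) auto
  then have "restrict g (topspace K) \<in> range \<phi>"
    using rep unfolding yosida_representation_def cont_funs_def by (auto simp: bij_betw_def)
  then show ?thesis using assms(2) by (simp add: f_inv_into_f)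
qed

lemma mult: "k \<in> topspace K \<Longrightarrow> \<phi> (riesz_mult K \<phi> x y) k = \<phi> x k * \<phi> y k"
  unfolding riesz_mult_def by (intro inv_restrict continuous_map_real_mult continuous)

lemma exp: "k \<in> topspace K \<Longrightarrow> \<phi> (riesz_exp K \<phi> x) k = exp (\<phi> x k)"
  unfolding riesz_exp_def
proof (intro inv_restrict)
  have "continuous_map euclideanreal euclideanreal exp"
    by (simp add: continuous_on_exp)
  from continuous_map_compose[OF continuous this]
  show "continuous_map K euclideanreal (\<lambda>k. exp (\<phi> x k))" by (simp only: o_def)
qed

text \<open>For a real \<open>a\<close>, the minimum of \<open>a\<close> and \<open>1 - a\<close> is
  0 exactly when \<open>a\<close> is 0 or 1; components of \<open>u\<close> are thus indicator
  functions.\<close>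

lemma component_iff: "inf e (u - e) = 0 \<longleftrightarrow> (\<forall>k\<in>topspace K. \<phi> e k \<in> {0, 1})"
  by (auto simp: eq_iff[of "inf e (u - e)"] pointwise min_def split: if_splits)

lemma gauge_norm_bound:
  assumes "strong_order_unit u" "k \<in> topspace K"
  shows "\<bar>\<phi> x k\<bar> \<le> gauge_norm u x"
  unfolding gauge_norm_def
proof (rule cInf_greatest)
  \<comment> \<open>The strong order unit makes this set nonempty, so that its infimum is a genuine
    greatest lower bound.\<close>
  show "{\<beta>. \<bar>x\<bar> \<le> \<beta> *\<^sub>R u} \<noteq> {}"
    using assms(1) by (auto simp: strong_order_unit_def)
  show "\<bar>\<phi> x k\<bar> \<le> \<beta>" if "\<beta> \<in> {\<beta>. \<bar>x\<bar> \<le> \<beta> *\<^sub>R u}" for \<beta>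
    using that assms(2) by (auto simp: le_iff pointwise)
qed

end

section \<open>The moment computation and the tail bound\<close>

locale bernoulli = yosida K \<phi> u
  for K :: "'k topology" and \<phi> :: "'a::dedekind_complete_riesz_space \<Rightarrow> 'k \<Rightarrow> real" and u :: 'a +
  fixes T :: "'a \<Rightarrow> 'a" and P :: "nat \<Rightarrow> 'a \<Rightarrow> 'a" and f :: 'a
  assumes ce: "conditional_expectation T" and bp: "bernoulli_process K \<phi> u T P f"
begin

lemma linear_T: "linear T" and T_nonneg: "0 \<le> x \<Longrightarrow> 0 \<le> T x"
  using ce by (auto simp: conditional_expectation_def)

lemma T_unit: "T u = u" and T_P: "1 \<le> j \<Longrightarrow> T (P j u) = f"
  and P_band: "1 \<le> j \<Longrightarrow> band_projection (P j)"
  using bp by (auto simp: bernoulli_process_def)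

lemma T_mono: "x \<le> y \<Longrightarrow> T x \<le> T y"
  using T_nonneg[of "y - x"] by (simp add: linear_diff[OF linear_T])

section \<open>Infima of the \<open>P j u\<close> and their conditional moments\<close>

lemma P_01:
  assumes "1 \<le> j" "k \<in> topspace K"
  shows "\<phi> (P j u) k \<in> {0, 1}"
proof -
  obtain B where "band B" "P j = band_proj B"
    using P_band[OF assms(1)] unfolding band_projection_def by blast
  then have "inf (P j u) (u - P j u) = 0"
    using band_proj_nonneg(2)[OF _ unit_nonneg] by simp
  then show ?thesis using assms(2) by (simp only: component_iff)
qed

lemma P_nonneg: "1 \<le> j \<Longrightarrow> 0 \<le> P j u" and P_le_unit: "1 \<le> j \<Longrightarrow> P j u \<le> u"
  using P_01[of j] by (fastforce simp: le_iff pointwise)+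

lemma prod_P_01:
  assumes "finite A" "A \<subseteq> {1..}" "k \<in> topspace K"
  shows "(\<Prod>j\<in>A. \<phi> (P j u) k) \<in> {0, 1}"
  using assms(1,2)
proof (induction A)
  case (insert j A)
  then show ?case using P_01[of j k] assms(3) by auto
qed simp

text \<open>Inserting \<open>u\<close> avoids the infimum of an empty set and makes the empty case
  \<open>u\<close>, the counterpart of an empty product. For indices from 1 on it changes nothing
  else, since each \<open>P j u\<close> lies below \<open>u\<close>.\<close>

definition meet :: "nat set \<Rightarrow> 'a" where
  "meet A = Inf_fin (insert u ((\<lambda>j. P j u) ` A))"

lemma meet_empty: "meet {} = u"
  by (simp add: meet_def)

lemma meet_insert: "finite A \<Longrightarrow> meet (insert j A) = inf (P j u) (meet A)"
  unfolding meet_def by (simp add: insert_commute[of u])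

text \<open>On values 0 and 1 the minimum is the product.\<close>

lemma meet_eq_prod:
  assumes "finite A" "A \<subseteq> {1..}" "k \<in> topspace K"
  shows "\<phi> (meet A) k = (\<Prod>j\<in>A. \<phi> (P j u) k)"
  using assms(1,2)
proof (induction A)
  case empty
  then show ?case by (simp add: meet_empty unit assms)
next
  case (insert j A)
  have "(\<Prod>i\<in>A. \<phi> (P i u) k) \<in> {0, 1}"
    using insert assms(3) by (intro prod_P_01) auto
  moreover have "\<phi> (P j u) k \<in> {0, 1}" using insert P_01 assms(3) by auto
  ultimately show ?case
    using insert assms(3) by (simp add: meet_insert inf del: prod_zero_iff) (auto simp del: prod_zero_iff)
qed

lemma meet_component:
  assumes "finite A" "A \<subseteq> {1..}"
  shows "inf (meet A) (u - meet A) = 0"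
proof -
  have "(\<Prod>i\<in>A. \<phi> (P i u) k) \<in> {0, 1}" if "k \<in> topspace K" for k
    using assms that by (rule prod_P_01)
  then show ?thesis using assms by (simp add: component_iff meet_eq_prod)
qed

lemma meet_mem:
  assumes "finite A" "riesz_subspace S" "u \<in> S" "(\<lambda>j. P j u) ` A \<subseteq> S"
  shows "meet A \<in> S"
  using assms(1,4,2,3)
  by (induction A) (auto simp: meet_empty meet_insert riesz_subspace_def)

text \<open>Induction on \<open>A\<close>: the infimum over \<open>A\<close> is \<open>Q u\<close>
  for a band projection \<open>Q\<close>, which is independent of \<open>P j\<close> because
  \<open>A\<close> and \<open>{j}\<close> are disjoint index sets. Each new index therefore
  contributes one factor \<open>f\<close>.\<close>

lemma T_meet:
  assumes "finite A" "A \<subseteq> {1..}" "k \<in> topspace K"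
  shows "\<phi> (T (meet A)) k = \<phi> f k ^ card A"
  using assms(1,2)
proof (induction A)
  case empty
  then show ?case by (simp add: meet_empty T_unit unit assms)
next
  case (insert j A)
  have j: "1 \<le> j" using insert by auto
  have p: "0 \<le> P j u" "P j u \<le> u"
    using P_nonneg[OF j] P_le_unit[OF j] by auto
  show ?case
  \<comment> \<open>The empty set is treated apart because membership of \<open>u\<close> in the
    subspace generated over \<open>A\<close> is obtained from some \<open>E i\<close> with
    \<open>i\<close> in \<open>A\<close>.\<close>
  proof (cases "A = {}")
    case True
    then show ?thesis
      using p j by (simp add: meet_insert meet_empty inf.absorb1 T_P)
  next
    case False
    define E where "E = (\<lambda>i. closed_riesz_subspace_generated ({P i u} \<union> range T))"
    define G where "G = (\<lambda>I. closed_riesz_subspace_generated (\<Union>i\<in>I. E i))"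
    have E: "P i u \<in> E i" "u \<in> E i" for i
      using T_unit rangeI[of T u] by (auto simp: E_def closed_riesz_subspace_generated_def)
    have "subspaces_cond_indep K \<phi> u T (G A) (G {j})"
    proof -
      have "A \<subseteq> {1..} \<and> {j} \<subseteq> {1..} \<and> A \<inter> {j} = {}" using insert by auto
      then show ?thesis
        using bp unfolding bernoulli_process_def elements_cond_indep_def family_cond_indep_def
          G_def E_def by blast
    qed
    moreover obtain Q where Q: "band_projection Q" "\<And>p. 0 \<le> p \<Longrightarrow> p \<le> u \<Longrightarrow> Q p = inf (meet A) p"
      using component_band_projection meet_component insert by (metis insert_subset)
    have "meet A \<le> u"
      using meet_component[of A] insert by (metis diff_ge_0_iff_ge inf.cobounded2 insert_subset)
    then have Qu: "Q u = meet A"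
      using Q(2)[OF unit_nonneg order_refl] by (simp add: inf.absorb1)
    have "Q u \<in> G A"
      unfolding Qu G_def closed_riesz_subspace_generated_def
    proof (rule InterI, clarify)
      fix S assume S: "riesz_subspace S" "(\<Union>i\<in>A. E i) \<subseteq> S"
      show "meet A \<in> S"
      proof (rule meet_mem[OF \<open>finite A\<close> S(1)])
        show "u \<in> S" using S(2) False E(2) by blast
        show "(\<lambda>j. P j u) ` A \<subseteq> S" using S(2) E(1) by blast
      qed
    qed
    moreover have "P j u \<in> G {j}"
      using E(1) by (auto simp: G_def closed_riesz_subspace_generated_def)
    ultimately have "T (Q (P j u)) = riesz_mult K \<phi> (T (Q u)) (T (P j u))"
      using Q(1) P_band[OF j] unfolding subspaces_cond_indep_def projections_cond_indep_def by blast
    \<comment> \<open>Applying \<open>Q\<close> to \<open>P j u\<close> gives the infimum with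
      \<open>meet A\<close>, which is the infimum over the enlarged set.\<close>
    then have "T (meet (insert j A)) = riesz_mult K \<phi> (T (meet A)) f"
      using Q(2)[OF p] Qu T_P[OF j] insert by (simp add: meet_insert inf_commute)
    then show ?thesis
      using insert assms(3) by (simp add: mult)
  qed
qed

text \<open>Expanding the product over subsets reduces the action of \<open>T\<close> to linearity
  and the moments in \<open>T_meet\<close>; the expansion is then folded back with \<phi> f k in
  place of each factor.\<close>

lemma moment_generating_function:
  obtains X where
    "\<And>k. k \<in> topspace K \<Longrightarrow> \<phi> X k = (\<Prod>j=1..n. 1 + c * \<phi> (P j u) k)"
    "\<And>k. k \<in> topspace K \<Longrightarrow> \<phi> (T X) k = (1 + c * \<phi> f k) ^ n"
proof
  define X where "X = (\<Sum>A\<in>Pow {1..n}. c ^ card A *\<^sub>R meet A)"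
  have sub: "finite A" "A \<subseteq> {1..}" if "A \<in> Pow {1..n}" for A
    using that by (auto intro: finite_subset)
  fix k assume k: "k \<in> topspace K"
  have expand: "(\<Prod>j=1..n. 1 + g j) = (\<Sum>A\<in>Pow {1..n}. \<Prod>j\<in>A. g j)" for g :: "nat \<Rightarrow> real"
    using prod_add[of "{1..n}" g "\<lambda>_. 1"] by (simp add: add.commute)
  show "\<phi> X k = (\<Prod>j=1..n. 1 + c * \<phi> (P j u) k)"
    unfolding expand X_def using sub k
    by (simp add: pointwise meet_eq_prod prod.distrib)
  have "\<phi> (T X) k = (\<Sum>A\<in>Pow {1..n}. \<Prod>j\<in>A. c * \<phi> f k)"
    unfolding X_def using sub k
    by (simp add: linear_sum[OF linear_T] linear_scale[OF linear_T] pointwise T_meet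
        power_mult_distrib)
  then show "\<phi> (T X) k = (1 + c * \<phi> f k) ^ n"
    unfolding expand[symmetric] by simp
qed

section \<open>The tail component and its exponential bound\<close>

definition tail :: "nat \<Rightarrow> real \<Rightarrow> 'a" where
  "tail n t = band_proj (band_generated {pprt ((\<Sum>j=1..n. P j u) - t *\<^sub>R u)}) u"

lemma tail_01: "k \<in> topspace K \<Longrightarrow> \<phi> (tail n t) k \<in> {0, 1}"
  using band_proj_nonneg(2)[OF band_band_generated unit_nonneg]
  unfolding tail_def component_iff by (rule bspec)

text \<open>The negative part of \<open>y\<close> is disjoint from its positive part, hence from the
  whole band and from the tail. Where the tail is nonzero, the negative part must vanish.\<close>

lemma tail_imp_ge:
  assumes "k \<in> topspace K" "\<phi> (tail n t) k \<noteq> 0"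
  shows "t \<le> (\<Sum>j=1..n. \<phi> (P j u) k)"
proof -
  define y where "y = (\<Sum>j=1..n. P j u) - t *\<^sub>R u"
  have "inf \<bar>pprt y\<bar> \<bar>pprt (- y)\<bar> = 0"
    by (auto simp: eq_iff[of "inf _ _"] pprt_def pointwise min_def max_def)
  moreover have "tail n t \<in> band_generated {pprt y}"
    unfolding tail_def y_def by (rule band_proj_nonneg(1)[OF band_band_generated unit_nonneg])
  ultimately have "inf \<bar>tail n t\<bar> \<bar>pprt (- y)\<bar> = 0"
    by (rule band_generated_disjoint)
  then have "\<phi> (inf \<bar>tail n t\<bar> \<bar>pprt (- y)\<bar>) k = 0"
    using assms(1) by (simp add: zero)
  then have "min \<bar>\<phi> (tail n t) k\<bar> \<bar>max (- \<phi> y k) 0\<bar> = 0"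
    using assms(1) by (simp add: pointwise pprt_def)
  then have "0 \<le> \<phi> y k" using assms(2) by (auto simp: min_def max_def split: if_splits)
  then show ?thesis using assms(1) by (simp add: y_def pointwise)
qed

text \<open>Markov's inequality for an exponential: where the tail is 1, the value \<open>s\<close>
  of the sum is at least \<open>t\<close>, so the tail is pointwise at most
  \<open>(1 + c) powr (s - t)\<close>. Monotonicity of \<open>T\<close> transfers this to
  conditional expectations.\<close>

lemma tail_bound:
  assumes "c > 0" "k \<in> topspace K"
  shows "\<phi> (T (tail n t)) k \<le> (1 + c) powr (- t) * (1 + c * \<phi> f k) ^ n"
proof -
  obtain X where X: "\<And>k. k \<in> topspace K \<Longrightarrow> \<phi> X k = (\<Prod>j=1..n. 1 + c * \<phi> (P j u) k)"
    "\<And>k. k \<in> topspace K \<Longrightarrow> \<phi> (T X) k = (1 + c * \<phi> f k) ^ n"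
    using moment_generating_function[of c n] by blast
  have "\<phi> (tail n t) k \<le> \<phi> ((1 + c) powr (- t) *\<^sub>R X) k" if k: "k \<in> topspace K" for k
  proof -
    define s where "s = (\<Sum>j=1..n. \<phi> (P j u) k)"
    \<comment> \<open>For \<open>p\<close> in {0, 1} the affine \<open>1 + c * p\<close> equals the
      power \<open>(1 + c) powr p\<close>, so the product becomes a power of the sum.\<close>
    have "(\<Prod>j=1..n. 1 + c * \<phi> (P j u) k) = (\<Prod>j=1..n. (1 + c) powr \<phi> (P j u) k)"
      using P_01[OF _ k] assms(1) by (intro prod.cong) force+
    also have "\<dots> = (1 + c) powr s"
      using assms(1) by (simp add: s_def powr_sum)
    finally have eq: "\<phi> ((1 + c) powr (- t) *\<^sub>R X) k = (1 + c) powr (s - t)"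
      using k X(1) by (simp add: pointwise flip: powr_add)
    show ?thesis
    proof (cases "\<phi> (tail n t) k = 0")
      case True
      then show ?thesis by (simp add: eq)
    next
      case False
      then have "\<phi> (tail n t) k = 1" using tail_01[OF k] by auto
      moreover have "t \<le> s" unfolding s_def using k False by (rule tail_imp_ge)
      ultimately show ?thesis using assms(1) by (simp add: eq ge_one_powr_ge_zero)
    qed
  qed
  then have "T (tail n t) \<le> T ((1 + c) powr (- t) *\<^sub>R X)"
    by (intro T_mono) (simp add: le_iff)
  then show ?thesis
    using assms(2) X(2) by (simp add: le_iff linear_scale[OF linear_T] scaleR)
qed

section \<open>The degenerate case and the choice of the Chernoff parameter\<close>

lemma f_nonneg: "0 \<le> f"
proof -
  have "0 \<le> T (P 1 u)" by (intro T_nonneg P_nonneg) simp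
  then show ?thesis using T_P[of 1] by simp
qed

text \<open>Strict positivity turns zero expectation into \<open>P j u = 0\<close>. A nonzero value
  of the tail would then give t \<le> 0.\<close>

lemma tail_eq_zero:
  assumes "f = 0" "strictly_positive T" "0 < t"
  shows "tail n t = 0"
proof -
  have "P j u = 0" if "1 \<le> j" for j
  proof -
    have "T \<bar>P j u\<bar> = 0"
      using T_P[OF that] assms(1) P_nonneg[OF that] by (simp add: abs_of_nonneg)
    then show ?thesis using assms(2) unfolding strictly_positive_def by blast
  qed
  then have "\<phi> (tail n t) k = 0" if "k \<in> topspace K" for k
    using tail_imp_ge[OF that, of n t] assms(3) that by (auto simp: zero)
  then show ?thesis by (simp add: eq_iff[of "tail n t"] zero)
qed

lemma chernoff_bound:
  assumes "strong_order_unit u" "strictly_positive T" "1 \<le> n" "0 < t"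
    and t: "real n * gauge_norm u f < t"
  shows "T (tail n t)
    \<le> ((real n * exp 1 * gauge_norm u f / t) powr t) *\<^sub>R riesz_exp K \<phi> (- (real n *\<^sub>R f))"
proof -
  define g where "g = gauge_norm u f"
  have f: "0 \<le> \<phi> f k" "\<phi> f k \<le> g" if "k \<in> topspace K" for k
    using f_nonneg gauge_norm_bound[OF assms(1) that, of f] that
    by (auto simp: g_def le_iff zero)
  show ?thesis
  proof (cases "g > 0")
    \<comment> \<open>Here \<open>g\<close> cannot serve as a denominator. But the values of
      \<open>f\<close> lie between 0 and \<open>g\<close>, so \<open>f = 0\<close>; the left-hand
      side vanishes and the bound is nonnegative.\<close>
    case False
    then have "f = 0"
      using f by (fastforce simp: eq_iff[of f] zero)
    then show ?thesis
      using tail_eq_zero[OF _ assms(2,4)] linear_0[OF linear_T] by (simp add: le_iff pointwise exp)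
  next
    case True
    \<comment> \<open>This \<open>c\<close> minimises
      \<open>(1 + c) powr (- t) * exp (n * c * g)\<close>; its positivity is exactly the hypothesis
      that \<open>t\<close> exceeds \<open>n * g\<close>.\<close>
    define c where "c = t / (n * g) - 1"
    have ng: "0 < n * g" using True assms(3) by simp
    have c: "c > 0" "1 + c = t / (n * g)" using t ng by (auto simp: c_def g_def)
    have "\<phi> (T (tail n t)) k \<le> (real n * exp 1 * g / t) powr t * exp (- (n * \<phi> f k))"
      if k: "k \<in> topspace K" for k
    proof -
      have "\<phi> (T (tail n t)) k \<le> (1 + c) powr (- t) * (1 + c * \<phi> f k) ^ n"
        using c(1) k by (rule tail_bound)
      also have "\<dots> \<le> (1 + c) powr (- t) * exp (c * \<phi> f k) ^ n"
        using c(1) f(1)[OF k] by (intro mult_left_mono power_mono) auto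
      also have "exp (c * \<phi> f k) ^ n = exp (t * (\<phi> f k / g) - n * \<phi> f k)"
        using True assms(3) by (simp add: exp_of_nat_mult[symmetric] c_def field_simps)
      \<comment> \<open>Since \<phi> f k \<le> g, the quotient is at most 1. Bounding only this term
        keeps the factor \<open>exp (- (n * \<phi> f k))\<close> of the claim.\<close>
      also have "\<dots> \<le> exp (t - n * \<phi> f k)"
        using assms(4) True f(2)[OF k] by (simp add: mult_le_cancel_left1 field_simps)
      also have "(1 + c) powr (- t) = (n * g / t) powr t"
        using ng assms(4) unfolding c(2) by (simp add: powr_minus powr_divide field_simps)
      also have "(n * g / t) powr t * exp (t - n * \<phi> f k)
          = (n * g / t) powr t * exp 1 powr t * exp (- (n * \<phi> f k))"
        by (simp add: powr_def exp_diff exp_minus field_simps)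
      \<comment> \<open>The factor \<open>exp t\<close>, written as \<open>exp 1 powr t\<close>, is
        absorbed into the base.\<close>
      also have "(n * g / t) powr t * exp 1 powr t = (real n * exp 1 * g / t) powr t"
        using ng assms(4) by (subst powr_mult[symmetric]) (auto simp: field_simps)
      finally show ?thesis by (simp add: mult_left_mono)
    qed
    then show ?thesis by (simp add: le_iff pointwise exp g_def)
  qed
qed

end

theorem theorem5p3:
  fixes u f :: "'a::dedekind_complete_riesz_space"
    and K :: "'k topology"
    and \<phi> :: "'a \<Rightarrow> 'k \<Rightarrow> real"
    and T :: "'a \<Rightarrow> 'a"
    and P :: "nat \<Rightarrow> 'a \<Rightarrow> 'a"
    and n :: nat
    and t :: real
  assumes "strong_order_unit u"
    and "yosida_representation K \<phi> u"
    and "conditional_expectation T"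
    and "strictly_positive T"
    and "T u = u"
    and "bernoulli_process K \<phi> u T P f"
    and "n \<ge> 1"
    and "t > 0"
    and "t > real n * gauge_norm u f"
  shows "T (band_proj (band_generated {pprt ((\<Sum>j=1..n. P j u) - t *\<^sub>R u)}) u)
    \<le> ((real n * exp 1 * gauge_norm u f / t) powr t) *\<^sub>R riesz_exp K \<phi> (- (real n *\<^sub>R f))"
proof -
  interpret bernoulli K \<phi> u T P f
    using assms by unfold_locales
  show ?thesis
    using chernoff_bound[OF assms(1,4,7,8,9)] by (simp only: tail_def)
qed

end
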